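(* For every graph $G$, $$\Omega_1(G)\le \tfrac{1}{2}\Omega_{2}(G)\le \tfrac{1}{3}\Omega_{3}(G) \le \cdots \le |V(G)|;$$ that is, for every positive integer $m$, $\frac{1}{m}\Omega_m(G)\le \frac{1}{m+1}\Omega_{m+1}(G)\le |V(G)|$.
   Context: Graphs are finite, loopless, and may have multiple edges. A graph is $m$-tree-connected if it contains $m$ pairwise edge-disjoint spanning trees (a one-vertex graph is $m$-tree-connected). The $m$-tree-connected components of $G$ are its maximal induced $m$-tree-connected subgraphs; their vertex sets partition $V(G)$. For a partition $P$ of $V(G)$, $e_G(P)$ is the number of edges with ends in different parts. $\Omega_m(G)=m|P|-e_G(P)$ where $P$ is the partition into vertex sets of the $m$-tree-connected components (so $\Omega_1(G)$ is the number of components of $G$). *)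

theory Defs
  imports Complex_Main
begin

text \<open>
  Multigraphs: edges have their own identity, and \<open>ends\<close> assigns to each edge its set of
  end vertices, so parallel edges are distinct elements with equal \<open>ends\<close>. The values of
  \<open>ends\<close> outside \<open>edges\<close> are irrelevant.
\<close>

record ('v, 'e) mgraph =
  verts :: "'v set"
  edges :: "'e set"
  ends :: "'e \<Rightarrow> 'v set"

text \<open>The condition \<open>card (ends G e) = 2\<close> excludes loops. The null graph is allowed.\<close>

definition multigraph :: "('v, 'e) mgraph \<Rightarrow> bool" where
  "multigraph G \<longleftrightarrow> finite (verts G) \<and> finite (edges G) \<and>
     (\<forall>e\<in>edges G. ends G e \<subseteq> verts G \<and> card (ends G e) = 2)"

definition induced :: "('v, 'e) mgraph \<Rightarrow> 'v set \<Rightarrow> ('v, 'e) mgraph" where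
  "induced G U = G\<lparr>verts := U, edges := {e \<in> edges G. ends G e \<subseteq> U}\<rparr>"

definition adj :: "('v, 'e) mgraph \<Rightarrow> ('v \<times> 'v) set" where
  "adj G = {(u, v). \<exists>e\<in>edges G. ends G e = {u, v}}"

definition connected_graph :: "('v, 'e) mgraph \<Rightarrow> bool" where
  "connected_graph G \<longleftrightarrow>
     verts G \<noteq> {} \<and> (\<forall>u\<in>verts G. \<forall>v\<in>verts G. (u, v) \<in> (adj G)\<^sup>*)"

text \<open>
  The cycle runs through \<open>vs ! 0, es ! 0, vs ! 1, es ! 1, \<dots>\<close> and closes up. Length 2 is
  allowed: two parallel edges form a cycle.
\<close>

definition is_cycle :: "('v, 'e) mgraph \<Rightarrow> 'v list \<Rightarrow> 'e list \<Rightarrow> bool" where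
  "is_cycle G vs es \<longleftrightarrow>
     length vs = length es \<and> length es \<ge> 2 \<and> distinct vs \<and> distinct es \<and>
     set vs \<subseteq> verts G \<and> set es \<subseteq> edges G \<and>
     (\<forall>i<length es. ends G (es ! i) = {vs ! i, vs ! (Suc i mod length es)})"

definition is_tree :: "('v, 'e) mgraph \<Rightarrow> bool" where
  "is_tree G \<longleftrightarrow> connected_graph G \<and> \<not> (\<exists>vs es. is_cycle G vs es)"

text \<open>A spanning tree is represented by its edge set.\<close>

definition spanning_tree :: "('v, 'e) mgraph \<Rightarrow> 'e set \<Rightarrow> bool" where
  "spanning_tree G T \<longleftrightarrow> T \<subseteq> edges G \<and> is_tree (G\<lparr>edges := T\<rparr>)"

text \<open>
  The trees form an indexed family, so in a one-vertex graph the empty edge set may be used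
  \<open>m\<close> times, and such a graph is \<open>m\<close>-tree-connected for every \<open>m\<close>.
\<close>

definition tree_connected :: "nat \<Rightarrow> ('v, 'e) mgraph \<Rightarrow> bool" where
  "tree_connected m G \<longleftrightarrow>
     (\<exists>T :: nat \<Rightarrow> 'e set. (\<forall>i<m. spanning_tree G (T i)) \<and>
        (\<forall>i<m. \<forall>j<m. i \<noteq> j \<longrightarrow> T i \<inter> T j = {}))"

text \<open>
  The vertex sets of the \<open>m\<close>-tree-connected components; an induced subgraph is determined
  by its vertex set, and containment of induced subgraphs is inclusion of vertex sets.
\<close>

definition tc_components :: "nat \<Rightarrow> ('v, 'e) mgraph \<Rightarrow> 'v set set" where
  "tc_components m G =
     {U. U \<subseteq> verts G \<and> tree_connected m (induced G U) \<and>
         \<not> (\<exists>W. U \<subset> W \<and> W \<subseteq> verts G \<and> tree_connected m (induced G W))}"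

definition cross_edges :: "('v, 'e) mgraph \<Rightarrow> 'v set set \<Rightarrow> 'e set" where
  "cross_edges G P =
     {e \<in> edges G. \<exists>u v. ends G e = {u, v} \<and> (\<exists>A\<in>P. \<exists>B\<in>P. A \<noteq> B \<and> u \<in> A \<and> v \<in> B)}"

definition Omega :: "nat \<Rightarrow> ('v, 'e) mgraph \<Rightarrow> int" where
  "Omega m G = int m * int (card (tc_components m G))
     - int (card (cross_edges G (tc_components m G)))"

end

(*
  Let k = m + 1, and let P and Q be the partitions into m- and k-tree-connected components. Q refines
  P, so it suffices to show that at most k (|Q| - |P|) edges lie inside P but not inside Q. In the
  graphic matroid contracted by the edges inside Q, an edge set X with |X| > k r(X) would contain,
  by Edmonds' matroid partition theorem applied to a minimal such set less one edge, k disjoint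
  spanning subsets of a nonempty Y. Together with tree packings of the parts of Q these make a union
  of several parts of Q k-tree-connected, against the maximality of the parts.
*)
theory Submission
  imports Defs
begin

text \<open>Dividing by the index turns \<open>Omega m G\<close> into |P| - e(P)/m. This explains
  the constant k: after division by k, at most k (|Q| - |P|) additional cross edges cost at most |Q|
  - |P|, which is the gain in parts, and the old cross edges weigh no more over k than over m. The
  number |Q| - |P| is itself a rank, that of the edges inside P once the edges inside Q are
  contracted, so a bound in terms of rank is the natural target. Contraction does no harm to
  packings, because each of the k trees of a part of Q already links that whole part; every
  contracted vertex can thus be expanded in all k sets at once. One edge has to be given up because
  a set larger than k times its rank cannot be covered by k independent sets. The violation is
  strict and between integers, so the remaining elements still suffice for k independent sets of
  full rank.\<close>

section \<open>Partition into independent sets\<close>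

text \<open>Edmonds' partition theorem in a list version. As in the short proof of Rado's theorem, a list
  with two colours can always be shortened by one of them, by submodularity; once all lists are
  singletons the counting condition says that every colour class is independent.\<close>

lemma colouring_from_lists:
  fixes r :: "'a set \<Rightarrow> int" and L :: "'a \<Rightarrow> nat set" and k :: nat
  assumes X: "finite X"
    and r_le: "\<And>S. S \<subseteq> X \<Longrightarrow> r S \<le> int (card S)"
    and r_mono: "\<And>S T. S \<subseteq> T \<Longrightarrow> T \<subseteq> X \<Longrightarrow> r S \<le> r T"
    and r_sub: "\<And>S T. S \<subseteq> X \<Longrightarrow> T \<subseteq> X \<Longrightarrow> r (S \<union> T) + r (S \<inter> T) \<le> r S + r T"
    and "\<And>e. e \<in> X \<Longrightarrow> L e \<noteq> {} \<and> L e \<subseteq> {..<k}"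
    and "\<And>S. S \<subseteq> X \<Longrightarrow> int (card S) \<le> (\<Sum>i<k. r {e \<in> S. i \<in> L e})"
  shows "\<exists>c. (\<forall>e\<in>X. c e < k) \<and> (\<forall>i<k. r {e \<in> X. c e = i} = int (card {e \<in> X. c e = i}))"
  using assms(5,6)
proof (induction "\<Sum>e\<in>X. card (L e)" arbitrary: L rule: less_induct)
  case less
  have finL: "finite (L e)" if "e \<in> X" for e
    using less.prems(1)[OF that] finite_subset by blast
  show ?case
  proof (cases "\<forall>e\<in>X. \<exists>i. L e = {i}")
    case True
    then obtain c where c: "\<And>e. e \<in> X \<Longrightarrow> L e = {c e}" by metis
    have eq: "{e \<in> X. i \<in> L e} = {e \<in> X. c e = i}" for i
      using c by auto
    have ck: "\<forall>e\<in>X. c e < k" using c less.prems(1) by auto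
    have "X = (\<Union>i<k. {e \<in> X. c e = i})" using ck by auto
    then have "card X = card (\<Union>i<k. {e \<in> X. c e = i})" by simp
    also have "\<dots> = (\<Sum>i<k. card {e \<in> X. c e = i})"
      by (rule card_UN_disjoint) (use X in auto)
    finally have cX: "int (card X) = (\<Sum>i<k. int (card {e \<in> X. c e = i}))" by simp
    have le: "r {e \<in> X. c e = i} \<le> int (card {e \<in> X. c e = i})" for i
      by (rule r_le) auto
    \<comment> \<open>The counting condition for \<open>X\<close> itself squeezes the sum of the
      ranks against the sum of the sizes. No single rank exceeds its size, so equality holds class
      by class.\<close>
    have "(\<Sum>i<k. int (card {e \<in> X. c e = i})) \<le> (\<Sum>i<k. r {e \<in> X. c e = i})"
      using less.prems(2)[of X] cX eq by simp
    then have "(\<Sum>i<k. int (card {e \<in> X. c e = i}) - r {e \<in> X. c e = i}) \<le> 0"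
      by (simp add: sum_subtractf)
    moreover have "(\<Sum>i<k. int (card {e \<in> X. c e = i}) - r {e \<in> X. c e = i}) \<ge> 0"
      using le by (intro sum_nonneg) (simp add: le)
    ultimately have "(\<Sum>i<k. int (card {e \<in> X. c e = i}) - r {e \<in> X. c e = i}) = 0" by simp
    then have "\<forall>i\<in>{..<k}. int (card {e \<in> X. c e = i}) - r {e \<in> X. c e = i} = 0"
      by (subst (asm) sum_nonneg_eq_0_iff) (use le in auto)
    then show ?thesis using ck by (intro exI[of _ c]) auto
  next
    case False
    then obtain x a b where x: "x \<in> X" and ab: "a \<in> L x" "b \<in> L x" "a \<noteq> b"
      using less.prems(1) by (metis ex_in_conv insertI1 singletonD subsetI subset_singletonD)
    define L' where "L' j = L(x := L x - {j})" for j
    define f where "f M S = (\<Sum>i<k. r {e \<in> S. i \<in> M e})" for M :: "'a \<Rightarrow> nat set" and S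
    have good: ?thesis if j: "j \<in> L x" "L x - {j} \<noteq> {}"
      and ok: "\<And>S. S \<subseteq> X \<Longrightarrow> int (card S) \<le> f (L' j) S" for j
    proof (rule less.hyps)
      show "(\<Sum>e\<in>X. card (L' j e)) < (\<Sum>e\<in>X. card (L e))"
      proof (rule sum_strict_mono_ex1[OF X])
        show "\<forall>e\<in>X. card (L' j e) \<le> card (L e)"
          using finL by (auto simp: L'_def intro: card_mono)
        show "\<exists>e\<in>X. card (L' j e) < card (L e)"
          using x card_Diff1_less[OF finL[OF x] j(1)] by (intro bexI[of _ x]) (simp_all add: L'_def)
      qed
    next
      fix e assume "e \<in> X"
      then show "L' j e \<noteq> {} \<and> L' j e \<subseteq> {..<k}"
        using less.prems(1) j by (auto simp: L'_def)
    next
      fix S assume "S \<subseteq> X"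
      then show "int (card S) \<le> (\<Sum>i<k. r {e \<in> S. i \<in> L' j e})"
        using ok unfolding f_def by blast
    qed
    show ?thesis
    proof (rule ccontr)
      assume no: "\<not> ?thesis"
      have bad: "\<exists>S\<subseteq>X. f (L' j) S < int (card S)" if "j \<in> L x" "L x - {j} \<noteq> {}" for j
      proof (rule ccontr)
        assume "\<not> (\<exists>S\<subseteq>X. f (L' j) S < int (card S))"
        then have "int (card S) \<le> f (L' j) S" if "S \<subseteq> X" for S using that by (simp add: not_less)
        then show False using good[OF that] no by simp
      qed
      have "L x - {a} \<noteq> {}" "L x - {b} \<noteq> {}" using ab by auto
      then obtain S T where S: "S \<subseteq> X" "f (L' a) S < int (card S)"
        and T: "T \<subseteq> X" "f (L' b) T < int (card T)"
        using bad[OF ab(1)] bad[OF ab(2)] by auto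
      \<comment> \<open>Shortening changes only the list at \<open>x\<close>, so a set that violates
        the shortened condition must contain \<open>x\<close>.\<close>
      have notin: "f (L' j) S = f L S" if "x \<notin> S" for j S
        unfolding f_def L'_def using that
        by (intro sum.cong refl arg_cong[of _ _ r]) auto
      have xS: "x \<in> S" using S notin[of S a] less.prems(2)[of S] unfolding f_def by force
      have xT: "x \<in> T" using T notin[of T b] less.prems(2)[of T] unfolding f_def by force
      \<comment> \<open>Uncrossing of the two violators. Colour \<open>a\<close> survives at
        \<open>x\<close> in \<open>L' b\<close> and colour \<open>b\<close> in \<open>L' a\<close>,
        so the union loses no colour; only the intersection has to give up \<open>x\<close>. That
        costs one element, while the two strict violations gain two.\<close>
      have "f L (S \<union> T) + f L (S \<inter> T - {x}) \<le> f (L' a) S + f (L' b) T"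
        unfolding f_def sum.distrib[symmetric]
      proof (rule sum_mono)
        fix i assume "i \<in> {..<k}"
        let ?A = "{e \<in> S. i \<in> L' a e}" and ?B = "{e \<in> T. i \<in> L' b e}"
        have 1: "{e \<in> S \<union> T. i \<in> L e} = ?A \<union> ?B"
          using xS xT ab by (auto simp: L'_def split: if_splits)
        have 2: "{e \<in> S \<inter> T - {x}. i \<in> L e} \<subseteq> ?A \<inter> ?B" by (auto simp: L'_def)
        have "r {e \<in> S \<inter> T - {x}. i \<in> L e} \<le> r (?A \<inter> ?B)"
          by (rule r_mono[OF 2]) (use S in auto)
        moreover have "r (?A \<union> ?B) + r (?A \<inter> ?B) \<le> r ?A + r ?B"
          by (rule r_sub) (use S T in auto)
        ultimately show "r {e \<in> S \<union> T. i \<in> L e} + r {e \<in> S \<inter> T - {x}. i \<in> L e} \<le> r ?A + r ?B"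
          unfolding 1 by linarith
      qed
      moreover have "int (card (S \<union> T)) \<le> f L (S \<union> T)"
        unfolding f_def by (rule less.prems(2)) (use S T in auto)
      moreover have "int (card (S \<inter> T - {x})) \<le> f L (S \<inter> T - {x})"
        unfolding f_def by (rule less.prems(2)) (use S T in auto)
      moreover have fin: "finite S" "finite T" using S T X finite_subset by blast+
      moreover have "card (S \<union> T) + card (S \<inter> T) = card S + card T"
        using card_Un_Int[OF fin] by simp
      moreover have "card (S \<inter> T - {x}) + 1 = card (S \<inter> T)"
        using xS xT fin by (simp add: card_Diff_singleton card_gt_0_iff) (metis IntI Suc_pred card_gt_0_iff empty_iff finite_Int)
      ultimately show False using S T by linarith
    qed
  qed
qed

text \<open>Take \<open>Y\<close> least among the sets that violate the count. All subsets of
  \<open>Y\<close> minus one element satisfy it, so this remainder splits into \<open>k\<close>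
  independent sets. Their ranks add up to |Y| - 1, which is at least \<open>k\<close> times the rank
  of \<open>Y\<close>; none exceeds the rank of \<open>Y\<close>, so all equal it.\<close>

lemma disjoint_spanning_subsets:
  fixes r :: "'a set \<Rightarrow> int" and k :: nat
  assumes X: "finite X"
    and r_le: "\<And>S. S \<subseteq> X \<Longrightarrow> r S \<le> int (card S)"
    and r_mono: "\<And>S T. S \<subseteq> T \<Longrightarrow> T \<subseteq> X \<Longrightarrow> r S \<le> r T"
    and r_sub: "\<And>S T. S \<subseteq> X \<Longrightarrow> T \<subseteq> X \<Longrightarrow> r (S \<union> T) + r (S \<inter> T) \<le> r S + r T"
    and r_empty: "r {} = 0"
    and k: "k \<ge> 1"
    and many: "int (card X) > int k * r X"
  shows "\<exists>Y C. Y \<subseteq> X \<and> Y \<noteq> {} \<and> (\<forall>i<k. C i \<subseteq> Y \<and> r (C i) = r Y) \<and>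
    (\<forall>i<k. \<forall>j<k. i \<noteq> j \<longrightarrow> C i \<inter> C j = {})"
proof -
  define bad where "bad S \<longleftrightarrow> S \<subseteq> X \<and> int (card S) > int k * r S" for S
  have "\<exists>Y. bad Y \<and> (\<forall>Z. bad Z \<longrightarrow> card Y \<le> card Z)"
    using many by (intro ex_has_least_nat[of bad X card]) (simp add: bad_def)
  then obtain Y where Y: "bad Y" and min: "\<And>Z. bad Z \<Longrightarrow> card Y \<le> card Z" by blast
  have YX: "Y \<subseteq> X" and cY: "int (card Y) > int k * r Y" using Y by (auto simp: bad_def)
  have fY: "finite Y" using YX X finite_subset by blast
  have "Y \<noteq> {}" using cY r_empty by auto
  then obtain y where y: "y \<in> Y" by blast
  let ?Z = "Y - {y}"
  have ZX: "?Z \<subseteq> X" using YX by blast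
  have sub: "int (card S) \<le> int k * r S" if "S \<subseteq> ?Z" for S
  proof (rule ccontr)
    assume "\<not> int (card S) \<le> int k * r S"
    then have "card Y \<le> card S" using that YX by (intro min) (auto simp: bad_def)
    moreover have "card S < card Y" using that y fY by (intro psubset_card_mono) auto
    ultimately show False by simp
  qed
  \<comment> \<open>With full lists, the sum over the colours in the list condition becomes
    \<open>k\<close> times the rank of \<open>S\<close>.\<close>
  have "\<exists>c. (\<forall>e\<in>?Z. c e < k) \<and> (\<forall>i<k. r {e \<in> ?Z. c e = i} = int (card {e \<in> ?Z. c e = i}))"
  proof (rule colouring_from_lists[where L = "\<lambda>_. {..<k}"])
    show "finite ?Z" using fY by simp
    show "r S \<le> int (card S)" if "S \<subseteq> ?Z" for S using that ZX r_le by blast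
    show "r S \<le> r T" if "S \<subseteq> T" "T \<subseteq> ?Z" for S T using that ZX r_mono by blast
    show "r (S \<union> T) + r (S \<inter> T) \<le> r S + r T" if "S \<subseteq> ?Z" "T \<subseteq> ?Z" for S T
      using that ZX by (intro r_sub) auto
    show "{..<k} \<noteq> {} \<and> {..<k} \<subseteq> {..<k}" using k by (auto simp: lessThan_empty_iff)
    show "int (card S) \<le> (\<Sum>i<k. r {e \<in> S. i \<in> {..<k}})" if "S \<subseteq> ?Z" for S
      using sub[OF that] by simp
  qed
  then obtain c where c: "\<forall>e\<in>?Z. c e < k"
    and ind: "\<And>i. i < k \<Longrightarrow> r {e \<in> ?Z. c e = i} = int (card {e \<in> ?Z. c e = i})" by blast
  let ?C = "\<lambda>i. {e \<in> ?Z. c e = i}"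
  have le: "r (?C i) \<le> r Y" for i by (rule r_mono) (use YX in auto)
  have "?Z = (\<Union>i<k. ?C i)" using c by auto
  then have "card ?Z = card (\<Union>i<k. ?C i)" by (rule arg_cong)
  also have "\<dots> = (\<Sum>i<k. card (?C i))"
    by (rule card_UN_disjoint) (use fY in auto)
  finally have "int (card ?Z) = (\<Sum>i<k. r (?C i))" using ind by simp
  moreover have "int (card ?Z) = int (card Y) - 1"
    using y fY by (simp add: card_Diff_singleton) (metis One_nat_def Suc_leI card_gt_0_iff empty_iff of_nat_1 of_nat_diff)
  ultimately have "(\<Sum>i<k. r Y - r (?C i)) \<le> 0" using cY by (simp add: sum_subtractf)
  moreover have "(\<Sum>i<k. r Y - r (?C i)) \<ge> 0" using le by (intro sum_nonneg) (simp add: le)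
  ultimately have "(\<Sum>i<k. r Y - r (?C i)) = 0" by simp
  then have "\<forall>i\<in>{..<k}. r Y - r (?C i) = 0"
    by (subst (asm) sum_nonneg_eq_0_iff) (use le in auto)
  then show ?thesis using YX \<open>Y \<noteq> {}\<close> by (intro exI[of _ Y] exI[of _ ?C]) auto
qed

section \<open>Connection by edge sets\<close>

text \<open>Reachability depends on an edge set instead of a graph, since the matroid arguments vary
  the edges over fixed vertices. Being reflexive everywhere, it makes a vertex without edges a class
  of its own.\<close>

definition link :: "('e \<Rightarrow> 'v set) \<Rightarrow> 'e set \<Rightarrow> ('v \<times> 'v) set" where
  "link f S = {(u, v). \<exists>e\<in>S. f e = {u, v}}\<^sup>*"

lemma link_refl [simp]: "(u, u) \<in> link f S"
  by (simp add: link_def)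

lemma link_trans: "(u, v) \<in> link f S \<Longrightarrow> (v, w) \<in> link f S \<Longrightarrow> (u, w) \<in> link f S"
  unfolding link_def by (rule rtrancl_trans)

lemma link_sym: "(u, v) \<in> link f S \<Longrightarrow> (v, u) \<in> link f S"
  unfolding link_def
  by (rule symD[OF sym_rtrancl]) (auto simp: sym_def insert_commute)

lemma link_edge: "e \<in> S \<Longrightarrow> f e = {u, v} \<Longrightarrow> (u, v) \<in> link f S"
  unfolding link_def by (intro r_into_rtrancl) auto

lemma link_least:
  assumes "\<And>e u v. e \<in> S \<Longrightarrow> f e = {u, v} \<Longrightarrow> (u, v) \<in> link f T"
  shows "link f S \<subseteq> link f T"
proof -
  have "{(u, v). \<exists>e\<in>S. f e = {u, v}} \<subseteq> link f T" using assms by auto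
  then have "link f S \<subseteq> (link f T)\<^sup>*" unfolding link_def[of f S] by (rule rtrancl_mono)
  then show ?thesis by (simp add: link_def)
qed

lemma link_mono: "S \<subseteq> T \<Longrightarrow> link f S \<subseteq> link f T"
  by (rule link_least) (auto intro: link_edge)

lemma link_class_eq: "link f S `` {u} = link f S `` {v} \<longleftrightarrow> (u, v) \<in> link f S"
  by (auto intro: link_trans link_sym)

text \<open>A walk from \<open>u\<close> never leaves the class of \<open>u\<close>. This allows an
  edge set spread over the whole graph to be cut down to one class.\<close>

lemma link_in_class:
  assumes "(u, v) \<in> link f S"
  shows "(u, v) \<in> link f {e \<in> S. f e \<subseteq> link f S `` {u}}"
  using assms[unfolded link_def]
proof (induction rule: rtrancl_induct)
  case (step y z)
  then obtain e where e: "e \<in> S" "f e = {y, z}" by auto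
  have "(u, y) \<in> link f S" using step(1) by (simp add: link_def)
  then have "f e \<subseteq> link f S `` {u}"
    using e link_trans[OF _ link_edge[of e S f y z]] by auto
  then have "(y, z) \<in> link f {e \<in> S. f e \<subseteq> link f S `` {u}}"
    using e by (intro link_edge) auto
  with step.IH show ?case by (rule link_trans)
qed simp

text \<open>A step along the new edge starts and ends in {u, v}, so the only effect is to merge the
  classes of \<open>u\<close> and \<open>v\<close>. If these already coincide, the second set of
  pairs adds nothing.\<close>

lemma link_insert:
  assumes "f e = {u, v}"
  shows "link f (insert e S) = link f S \<union>
    {(a, b). a \<in> link f S `` {u, v} \<and> b \<in> link f S `` {u, v}}" (is "_ = ?R")
proof
  have "(a, b) \<in> ?R" if "(a, b) \<in> link f (insert e S)" for a b
    using that unfolding link_def[of f "insert e S"]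
  proof (induction rule: rtrancl_induct)
    case (step y z)
    then obtain d where d: "d \<in> insert e S" "f d = {y, z}" by auto
    show ?case
    proof (cases "d \<in> S")
      case True
      then have "(y, z) \<in> link f S" using d link_edge by metis
      then show ?thesis using step.IH by (auto intro: link_trans)
    next
      case False
      then have yz: "y \<in> {u, v}" "z \<in> {u, v}" using d assms by auto
      then have "z \<in> link f S `` {u, v}" by (intro ImageI[of z z]) simp_all
      moreover have "a \<in> link f S `` {u, v}" using step.IH yz by (auto intro: link_sym)
      ultimately show ?thesis by simp
    qed
  qed simp
  then show "link f (insert e S) \<subseteq> ?R" by auto
  have S: "link f S \<subseteq> link f (insert e S)" by (rule link_mono) auto
  have uv: "(u, v) \<in> link f (insert e S)" using assms by (intro link_edge) auto
  have "(a, b) \<in> link f (insert e S)"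
    if "a \<in> link f S `` {u, v}" "b \<in> link f S `` {u, v}" for a b
  proof -
    have "(u, x) \<in> link f (insert e S)" if "x \<in> link f S `` {u, v}" for x
      using that S uv by (auto intro: link_trans)
    then show ?thesis using that by (meson link_sym link_trans)
  qed
  with S show "?R \<subseteq> link f (insert e S)" by auto
qed

definition classes :: "('e \<Rightarrow> 'v set) \<Rightarrow> 'v set \<Rightarrow> 'e set \<Rightarrow> 'v set set" where
  "classes f V S = (\<lambda>v. link f S `` {v}) ` V"

lemma classes_insert_linked:
  assumes "f e = {u, v}" "(u, v) \<in> link f S"
  shows "classes f V (insert e S) = classes f V S"
proof -
  have "link f (insert e S) \<subseteq> link f S"
  proof (rule link_least)
    fix d a b assume d: "d \<in> insert e S" "f d = {a, b}"
    show "(a, b) \<in> link f S"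
    proof (cases "d = e")
      case True
      then show ?thesis using d assms by (auto simp: doubleton_eq_iff intro: link_sym)
    qed (use d in \<open>auto intro: link_edge\<close>)
  qed
  then have "link f (insert e S) = link f S"
    using link_mono[of S "insert e S" f] by auto
  then show ?thesis by (simp add: classes_def)
qed

text \<open>Two different classes are replaced by their union; \<open>?D\<close> collects the
  classes that survive unchanged.\<close>

lemma card_classes_insert_unlinked:
  assumes V: "finite V" "u \<in> V" "v \<in> V" and e: "f e = {u, v}" and nl: "(u, v) \<notin> link f S"
  shows "card (classes f V S) = Suc (card (classes f V (insert e S)))"
proof -
  let ?c = "\<lambda>w. link f S `` {w}"
  let ?D = "classes f V S - {?c u, ?c v}"
  have c': "link f (insert e S) `` {w} = (if w \<in> ?c u \<union> ?c v then ?c u \<union> ?c v else ?c w)" for w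
    unfolding link_insert[of f e u v, OF e] by (auto intro: link_trans link_sym)
  have inD: "?c w \<in> ?D \<longleftrightarrow> w \<notin> ?c u \<union> ?c v" if "w \<in> V" for w
    using that link_class_eq[of f S w u] link_class_eq[of f S w v]
    by (auto simp: classes_def intro: link_sym)
  have new: "classes f V (insert e S) = insert (?c u \<union> ?c v) ?D" (is "?l = ?r")
  proof
    show "?l \<subseteq> ?r"
    proof
      fix A assume "A \<in> ?l"
      then obtain w where w: "w \<in> V" "A = link f (insert e S) `` {w}" by (auto simp: classes_def)
      then show "A \<in> ?r" using c'[of w] inD[of w] by (cases "w \<in> ?c u \<union> ?c v") simp_all
    qed
    show "?r \<subseteq> ?l"
    proof
      fix A assume "A \<in> ?r"
      then consider "A = ?c u \<union> ?c v" | w where "w \<in> V" "A = ?c w" "?c w \<in> ?D"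
        by (auto simp: classes_def)
      then show "A \<in> ?l"
      proof cases
        case 1
        then have "A = link f (insert e S) `` {u}" using c'[of u] by simp
        then show ?thesis using V by (auto simp: classes_def)
      next
        case 2
        then have "A = link f (insert e S) `` {w}" using c'[of w] inD[of w] by simp
        then show ?thesis using 2 by (auto simp: classes_def)
      qed
    qed
  qed
  have "?c u \<union> ?c v \<notin> ?D"
  proof
    assume "?c u \<union> ?c v \<in> ?D"
    then obtain w where w: "w \<in> V" "?c u \<union> ?c v = ?c w" "?c w \<in> ?D"
      by (auto simp: classes_def)
    have "w \<in> ?c w" by simp
    then show False using inD[OF w(1)] w by blast
  qed
  moreover have fin: "finite (classes f V S)" using V by (simp add: classes_def)
  ultimately have n: "card (classes f V (insert e S)) = Suc (card ?D)" using new by simp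
  have "?c u \<noteq> ?c v" using nl link_class_eq[of f S u v] by simp
  then have "card {?c u, ?c v} = 2" by simp
  moreover have sub: "{?c u, ?c v} \<subseteq> classes f V S" using V by (auto simp: classes_def)
  ultimately show ?thesis
    using n card_Diff_subset[of "{?c u, ?c v}" "classes f V S"] card_mono[OF fin sub] by simp
qed

text \<open>Enlarging each class of \<open>S\<close> to the class of \<open>T\<close> around it is a
  surjection. Between finite sets of equal size it is injective, so no class of \<open>T\<close>
  contains two classes of \<open>S\<close>. This is how equal rank yields equal span.\<close>

lemma classes_eq_imp_link_subset:
  assumes V: "finite V" and ST: "S \<subseteq> T" and c: "card (classes f V S) = card (classes f V T)"
    and uv: "u \<in> V" "v \<in> V" "(u, v) \<in> link f T"
  shows "(u, v) \<in> link f S"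
proof -
  let ?h = "\<lambda>A. link f T `` A"
  have h: "?h (link f S `` {w}) = link f T `` {w}" for w
    using link_mono[OF ST, of f] by (auto intro: link_trans)
  then have im: "?h ` classes f V S = classes f V T"
    by (auto simp: classes_def image_image)
  have "inj_on ?h (classes f V S)"
    by (rule eq_card_imp_inj_on) (use V c im in \<open>auto simp: classes_def\<close>)
  moreover have "?h (link f S `` {u}) = ?h (link f S `` {v})"
    unfolding h link_class_eq by (rule uv)
  ultimately have "link f S `` {u} = link f S `` {v}"
    using uv by (auto simp: inj_on_def classes_def)
  then show ?thesis by (simp add: link_class_eq)
qed

section \<open>The rank function of a multigraph\<close>

text \<open>The rank function of the graphic matroid: for a set of edges of \<open>G\<close>, the
  size of a spanning forest. Integer values make the differences used for contraction safe.\<close>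

definition rk :: "('v, 'e) mgraph \<Rightarrow> 'e set \<Rightarrow> int" where
  "rk G S = int (card (verts G)) - int (card (classes (ends G) (verts G) S))"

lemma multigraph_edgeE:
  assumes "multigraph G" "e \<in> edges G"
  obtains u v where "ends G e = {u, v}" "u \<noteq> v" "u \<in> verts G" "v \<in> verts G"
proof -
  have "card (ends G e) = 2" "ends G e \<subseteq> verts G" using assms by (auto simp: multigraph_def)
  then show thesis using that by (auto simp: card_2_iff)
qed

lemma rk_insert:
  assumes "multigraph G" "e \<in> edges G" "ends G e = {u, v}"
  shows "rk G (insert e S) = rk G S + (if (u, v) \<in> link (ends G) S then 0 else 1)"
proof -
  have "finite (verts G)" "u \<in> verts G" "v \<in> verts G"
    using assms by (auto simp: multigraph_def)
  then show ?thesis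
    using classes_insert_linked[of "ends G" e u v S "verts G"]
      card_classes_insert_unlinked[of "verts G" u v "ends G" e S] assms(3)
    by (auto simp: rk_def)
qed

text \<open>Diminishing returns: a larger base set has more links, so each edge of \<open>D\<close>
  raises its rank by no more than it raises that of the smaller one. One induction over
  \<open>D\<close> serves all three bounds.\<close>

lemma rk_union:
  assumes G: "multigraph G" and D: "D \<subseteq> edges G" and ST: "S \<subseteq> T"
  shows "rk G (T \<union> D) - rk G T \<le> rk G (S \<union> D) - rk G S"
    and "rk G S \<le> rk G (S \<union> D)"
    and "rk G (S \<union> D) \<le> rk G S + int (card D)"
proof -
  have "finite D" using G D finite_subset by (auto simp: multigraph_def)
  then have "rk G (T \<union> D) - rk G T \<le> rk G (S \<union> D) - rk G S \<and> rk G S \<le> rk G (S \<union> D) \<and>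
    rk G (S \<union> D) \<le> rk G S + int (card D)"
    using D
  proof (induction D rule: finite_induct)
    case (insert e D)
    obtain u v where e: "ends G e = {u, v}"
      using multigraph_edgeE[OF G, of e] insert.prems by (metis insert_subset)
    have "link (ends G) (S \<union> D) \<subseteq> link (ends G) (T \<union> D)"
      by (rule link_mono) (use ST in auto)
    then show ?case
      using insert rk_insert[OF G _ e, of "S \<union> D"] rk_insert[OF G _ e, of "T \<union> D"] by auto
  qed simp
  then show "rk G (T \<union> D) - rk G T \<le> rk G (S \<union> D) - rk G S"
    and "rk G S \<le> rk G (S \<union> D)"
    and "rk G (S \<union> D) \<le> rk G S + int (card D)" by auto
qed

lemma rk_mono: "multigraph G \<Longrightarrow> S \<subseteq> T \<Longrightarrow> T \<subseteq> edges G \<Longrightarrow> rk G S \<le> rk G T"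
  using rk_union(2)[of G T S S] by (simp add: Un_absorb1)

lemma rk_submodular:
  assumes "multigraph G" "S \<subseteq> edges G" "T \<subseteq> edges G"
  shows "rk G (S \<union> T) + rk G (S \<inter> T) \<le> rk G S + rk G T"
proof -
  have "rk G (T \<union> S) - rk G T \<le> rk G ((S \<inter> T) \<union> S) - rk G (S \<inter> T)"
    by (rule rk_union(1)) (use assms in auto)
  moreover have "(S \<inter> T) \<union> S = S" by auto
  ultimately show ?thesis by (simp add: Un_commute)
qed

section \<open>Packings of connected edge sets\<close>

definition inner :: "('v, 'e) mgraph \<Rightarrow> 'v set \<Rightarrow> 'e set" where
  "inner G U = {e \<in> edges G. ends G e \<subseteq> U}"

text \<open>For \<open>m \<ge> 1\<close> this is \<open>m\<close>-tree-connectivity of the subgraph induced on \<open>U\<close>: a packing of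
  connected edge sets contains a packing of trees, and conversely acyclicity can be dropped.\<close>

definition packing :: "nat \<Rightarrow> ('v, 'e) mgraph \<Rightarrow> 'v set \<Rightarrow> (nat \<Rightarrow> 'e set) \<Rightarrow> bool" where
  "packing m G U T \<longleftrightarrow> (\<forall>i<m. T i \<subseteq> inner G U \<and> U \<times> U \<subseteq> link (ends G) (T i)) \<and>
    (\<forall>i<m. \<forall>j<m. i \<noteq> j \<longrightarrow> T i \<inter> T j = {})"

lemma adj_edges: "(adj (G\<lparr>edges := T\<rparr>))\<^sup>* = link (ends G) T"
  by (simp add: adj_def link_def)

text \<open>The rest of the cycle is a path between the ends of its closing edge, which can
  therefore be bypassed.\<close>

lemma cycle_last_edge_redundant:
  assumes "is_cycle (G\<lparr>edges := T\<rparr>) vs es"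
  shows "\<exists>e\<in>T. link (ends G) T \<subseteq> link (ends G) (T - {e})"
proof -
  define n where "n = length es"
  have n: "length vs = n" "n \<ge> 2" "distinct es" "set es \<subseteq> T"
    and en: "\<And>i. i < n \<Longrightarrow> ends G (es ! i) = {vs ! i, vs ! (Suc i mod n)}"
    using assms by (auto simp: is_cycle_def n_def)
  let ?e = "es ! (n - 1)"
  have eT: "?e \<in> T" using n by (auto simp: n_def)
  have path: "(vs ! 0, vs ! i) \<in> link (ends G) (T - {?e})" if "i < n" for i
    using that
  proof (induction i)
    case (Suc i)
    have "es ! i \<in> T" using n Suc.prems by (auto simp: n_def)
    moreover have "es ! i \<noteq> ?e"
      using n Suc.prems by (simp add: n_def nth_eq_iff_index_eq)
    moreover have "ends G (es ! i) = {vs ! i, vs ! Suc i}" using en[of i] Suc.prems by simp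
    ultimately have "(vs ! i, vs ! Suc i) \<in> link (ends G) (T - {?e})" by (intro link_edge) auto
    then show ?case using Suc by (auto intro: link_trans)
  qed simp
  have last: "ends G ?e = {vs ! (n - 1), vs ! 0}" using en[of "n - 1"] n by simp
  have "link (ends G) T \<subseteq> link (ends G) (T - {?e})"
  proof (rule link_least)
    fix d u v assume d: "d \<in> T" "ends G d = {u, v}"
    show "(u, v) \<in> link (ends G) (T - {?e})"
    proof (cases "d = ?e")
      case True
      then show ?thesis using d last path[of "n - 1"] n
        by (auto simp: doubleton_eq_iff intro: link_sym)
    qed (use d in \<open>auto intro: link_edge\<close>)
  qed
  then show ?thesis using eT by blast
qed

text \<open>A subset of least size that still links \<open>U\<close> has no cycle, since an edge of
  a cycle could be dropped.\<close>

lemma spanning_tree_exists: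
  assumes "finite T" "T \<subseteq> inner G U" "U \<noteq> {}" "U \<times> U \<subseteq> link (ends G) T"
  shows "\<exists>S\<subseteq>T. spanning_tree (induced G U) S"
proof -
  define ok where "ok S \<longleftrightarrow> S \<subseteq> T \<and> U \<times> U \<subseteq> link (ends G) S" for S
  have "\<exists>S. ok S \<and> (\<forall>Z. ok Z \<longrightarrow> card S \<le> card Z)"
    using assms by (intro ex_has_least_nat[of ok T card]) (simp add: ok_def)
  then obtain S where S: "ok S" and min: "\<And>Z. ok Z \<Longrightarrow> card S \<le> card Z" by blast
  let ?H = "(induced G U)\<lparr>edges := S\<rparr>"
  \<comment> \<open>This form exposes a graph with the ends of \<open>G\<close> whose edge set is
    replaced, as \<open>cycle_last_edge_redundant\<close> expects.\<close>
  have H: "?H = (G\<lparr>verts := U\<rparr>)\<lparr>edges := S\<rparr>" by (simp add: induced_def)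
  have "\<not> is_cycle ?H vs es" for vs es
  proof
    assume "is_cycle ?H vs es"
    from cycle_last_edge_redundant[OF this[unfolded H]]
    obtain e where e: "e \<in> S" "link (ends G) S \<subseteq> link (ends G) (S - {e})" by auto
    then have "ok (S - {e})" using S by (auto simp: ok_def)
    then have "card S \<le> card (S - {e})" by (rule min)
    moreover have "finite S" using S assms(1) finite_subset by (auto simp: ok_def)
    ultimately show False using e card_Diff1_less[of S e] by simp
  qed
  moreover have "connected_graph ?H"
    using S assms(3) by (auto simp: connected_graph_def adj_edges ok_def induced_def)
  ultimately have "spanning_tree (induced G U) S"
    using S assms(2) by (auto simp: spanning_tree_def is_tree_def ok_def induced_def inner_def)
  then show ?thesis using S by (auto simp: ok_def)
qed

text \<open>Positivity of \<open>m\<close> matters for empty \<open>U\<close>: a family of no trees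
  exists there, whereas a single tree already forces a vertex.\<close>

lemma tree_connected_iff_packing:
  assumes G: "multigraph G" and m: "m \<ge> 1"
  shows "tree_connected m (induced G U) \<longleftrightarrow> U \<noteq> {} \<and> (\<exists>T. packing m G U T)"
proof
  assume "tree_connected m (induced G U)"
  then obtain T where T: "\<And>i. i < m \<Longrightarrow> spanning_tree (induced G U) (T i)"
    and d: "\<forall>i<m. \<forall>j<m. i \<noteq> j \<longrightarrow> T i \<inter> T j = {}"
    by (auto simp: tree_connected_def)
  have "U \<noteq> {}" using T[of 0] m
    by (auto simp: spanning_tree_def is_tree_def connected_graph_def induced_def)
  moreover have "T i \<subseteq> inner G U \<and> U \<times> U \<subseteq> link (ends G) (T i)" if "i < m" for i
    using T[OF that] by (auto simp: spanning_tree_def is_tree_def connected_graph_def adj_edges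
        induced_def inner_def)
  then have "packing m G U T" using d by (simp add: packing_def)
  ultimately show "U \<noteq> {} \<and> (\<exists>T. packing m G U T)" by blast
next
  assume "U \<noteq> {} \<and> (\<exists>T. packing m G U T)"
  then obtain T where U: "U \<noteq> {}" and T: "packing m G U T" by blast
  have "\<exists>S\<subseteq>T i. spanning_tree (induced G U) S" if "i < m" for i
  proof (rule spanning_tree_exists)
    show sub: "T i \<subseteq> inner G U" and "U \<times> U \<subseteq> link (ends G) (T i)"
      using T that by (auto simp: packing_def)
    show "finite (T i)"
      by (rule finite_subset[OF sub]) (use G in \<open>simp add: inner_def multigraph_def\<close>)
  qed (rule U)
  then obtain S where S: "\<And>i. i < m \<Longrightarrow> S i \<subseteq> T i \<and> spanning_tree (induced G U) (S i)" by metis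
  moreover have "S i \<inter> S j = {}" if "i < m" "j < m" "i \<noteq> j" for i j
  proof -
    have "T i \<inter> T j = {}" using T that by (auto simp: packing_def)
    then show ?thesis using S that by blast
  qed
  ultimately show "tree_connected m (induced G U)" unfolding tree_connected_def by blast
qed

text \<open>Edges of \<open>T i\<close> inside \<open>U\<close> are discarded, because another
  \<open>S j\<close> may use them. The links they gave are restored by \<open>S i\<close>, which
  links all of \<open>U\<close>; the common vertex \<open>x\<close> then joins both sides.\<close>

lemma packing_union:
  assumes U: "packing m G U S" and W: "packing m G W T" and x: "x \<in> U" "x \<in> W"
  shows "packing m G (U \<union> W) (\<lambda>i. S i \<union> (T i - inner G U))"
  unfolding packing_def
proof (intro conjI allI impI)
  fix i assume i: "i < m"
  let ?R = "S i \<union> (T i - inner G U)"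
  have S: "S i \<subseteq> inner G U" "U \<times> U \<subseteq> link (ends G) (S i)"
    and T: "T i \<subseteq> inner G W" "W \<times> W \<subseteq> link (ends G) (T i)"
    using U W i by (auto simp: packing_def)
  show "?R \<subseteq> inner G (U \<union> W)" using S(1) T(1) by (auto simp: inner_def)
  have SR: "link (ends G) (S i) \<subseteq> link (ends G) ?R" by (rule link_mono) auto
  have TR: "link (ends G) (T i) \<subseteq> link (ends G) ?R"
  proof (rule link_least)
    fix e u v assume e: "e \<in> T i" "ends G e = {u, v}"
    show "(u, v) \<in> link (ends G) ?R"
    proof (cases "e \<in> inner G U")
      case True
      then have "(u, v) \<in> U \<times> U" using e by (auto simp: inner_def)
      then show ?thesis using S SR by blast
    qed (use e in \<open>auto intro: link_edge\<close>)
  qed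
  have "(x, y) \<in> link (ends G) ?R" if "y \<in> U \<union> W" for y
    using that x S(2) T(2) SR TR by blast
  then show "(U \<union> W) \<times> (U \<union> W) \<subseteq> link (ends G) ?R"
    by (auto intro: link_trans link_sym)
next
  fix i j assume "i < m" "j < m" "i \<noteq> j"
  then have "S i \<inter> S j = {}" "T i \<inter> T j = {}" "S i \<subseteq> inner G U" "S j \<subseteq> inner G U"
    using U W by (auto simp: packing_def)
  then show "(S i \<union> (T i - inner G U)) \<inter> (S j \<union> (T j - inner G U)) = {}" by blast
qed

section \<open>The components as a partition\<close>

lemma packing_subset_component:
  assumes G: "multigraph G" and m: "m \<ge> 1" and U: "U \<subseteq> verts G" "U \<noteq> {}" "packing m G U T"
  shows "\<exists>W\<in>tc_components m G. U \<subseteq> W"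
proof -
  let ?F = "{W. W \<subseteq> verts G \<and> tree_connected m (induced G W)}"
  have "finite (verts G)" using G by (simp add: multigraph_def)
  then have "finite ?F" by (intro finite_subset[of ?F "Pow (verts G)"]) auto
  moreover have "U \<in> ?F" using U tree_connected_iff_packing[OF G m] by auto
  ultimately obtain W where "W \<in> ?F" "U \<subseteq> W" "\<forall>Z\<in>?F. W \<subseteq> Z \<longrightarrow> W = Z"
    using finite_has_maximal2[of ?F U] by auto
  then show ?thesis by (intro bexI[of _ W]) (auto simp: tc_components_def)
qed

lemma component_packing:
  assumes "multigraph G" "m \<ge> 1" "A \<in> tc_components m G"
  shows "A \<subseteq> verts G" "A \<noteq> {}" "\<exists>T. packing m G A T"
  using assms tree_connected_iff_packing[OF assms(1,2)] by (auto simp: tc_components_def)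

text \<open>Otherwise the union with \<open>W\<close> would be a larger tree-connected set, by
  \<open>packing_union\<close>. Disjointness of the parts and the final contradiction in
  \<open>card_cross_le\<close> both rest on this.\<close>

lemma component_absorbs:
  assumes G: "multigraph G" and m: "m \<ge> 1" and A: "A \<in> tc_components m G"
    and W: "W \<subseteq> verts G" "packing m G W T" "A \<inter> W \<noteq> {}"
  shows "W \<subseteq> A"
proof (rule ccontr)
  assume nW: "\<not> W \<subseteq> A"
  obtain x where x: "x \<in> A" "x \<in> W" using W by blast
  obtain S where "packing m G A S" using component_packing[OF G m A] by blast
  from packing_union[OF this W(2) x]
  have "tree_connected m (induced G (A \<union> W))"
    using tree_connected_iff_packing[OF G m] x by blast
  moreover have "A \<union> W \<subseteq> verts G" "A \<subset> A \<union> W"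
    using W nW component_packing[OF G m A] by auto
  ultimately show False using A unfolding tc_components_def by blast
qed

lemma components_disjoint:
  assumes G: "multigraph G" and m: "m \<ge> 1"
    and A: "A \<in> tc_components m G" and B: "B \<in> tc_components m G" and x: "x \<in> A" "x \<in> B"
  shows "A = B"
proof
  obtain S T where S: "packing m G A S" and T: "packing m G B T"
    using component_packing(3)[OF G m A] component_packing(3)[OF G m B] by auto
  show "A \<subseteq> B"
    by (rule component_absorbs[OF G m B component_packing(1)[OF G m A] S]) (use x in auto)
  show "B \<subseteq> A"
    by (rule component_absorbs[OF G m A component_packing(1)[OF G m B] T]) (use x in auto)
qed

lemma components_cover:
  assumes G: "multigraph G" and m: "m \<ge> 1" and "v \<in> verts G"
  shows "\<exists>A\<in>tc_components m G. v \<in> A"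
proof -
  have "packing m G {v} (\<lambda>_. {})" by (simp add: packing_def)
  then show ?thesis using packing_subset_component[OF G m, of "{v}"] assms(3) by auto
qed

text \<open>Forgetting the last set of a packing leaves a packing for \<open>m\<close>; hence the
  partition for \<open>Suc m\<close> refines the one for \<open>m\<close>.\<close>

lemma component_SucD:
  assumes G: "multigraph G" and m: "m \<ge> 1" and A: "A \<in> tc_components (Suc m) G"
  shows "\<exists>B\<in>tc_components m G. A \<subseteq> B"
proof -
  obtain T where "packing (Suc m) G A T" using component_packing[OF G _ A] by auto
  then have "packing m G A T" by (auto simp: packing_def)
  then show ?thesis using packing_subset_component[OF G m] component_packing[OF G _ A] by auto
qed

text \<open>The complement of the cross edges, and the set that gets contracted: its link classes
  are the components, so its rank counts them.\<close>

definition inside :: "nat \<Rightarrow> ('v, 'e) mgraph \<Rightarrow> 'e set" where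
  "inside m G = (\<Union>A\<in>tc_components m G. inner G A)"

lemma inside_subset: "inside m G \<subseteq> edges G"
  by (auto simp: inside_def inner_def)

lemma cross_edges_eq:
  assumes G: "multigraph G" and m: "m \<ge> 1"
  shows "cross_edges G (tc_components m G) = edges G - inside m G"
proof (intro set_eqI iffI)
  fix e assume "e \<in> cross_edges G (tc_components m G)"
  then obtain u v A B where e: "e \<in> edges G" "ends G e = {u, v}"
    and AB: "A \<in> tc_components m G" "B \<in> tc_components m G" "A \<noteq> B" "u \<in> A" "v \<in> B"
    by (auto simp: cross_edges_def)
  have "e \<notin> inner G C" if "C \<in> tc_components m G" for C
  proof
    assume "e \<in> inner G C"
    then have "u \<in> C" "v \<in> C" using e by (auto simp: inner_def)
    then have "A = C" "B = C"
      using components_disjoint[OF G m AB(1) that AB(4)] components_disjoint[OF G m AB(2) that AB(5)]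
      by auto
    then show False using AB(3) by simp
  qed
  then show "e \<in> edges G - inside m G" using e by (auto simp: inside_def)
next
  fix e assume e: "e \<in> edges G - inside m G"
  then obtain u v where uv: "ends G e = {u, v}" "u \<in> verts G" "v \<in> verts G"
    using multigraph_edgeE[OF G] by blast
  then obtain A B where AB: "A \<in> tc_components m G" "B \<in> tc_components m G" "u \<in> A" "v \<in> B"
    using components_cover[OF G m] by metis
  moreover have "A \<noteq> B" using e uv AB by (auto simp: inside_def inner_def)
  ultimately show "e \<in> cross_edges G (tc_components m G)"
    using e uv unfolding cross_edges_def by blast
qed

text \<open>Parts are disjoint, so an edge inside one part cannot lead out of another. Conversely,
  the single packing set with index 0 already links its part.\<close>

lemma link_inside:
  assumes G: "multigraph G" and m: "m \<ge> 1" and A: "A \<in> tc_components m G" and u: "u \<in> A"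
  shows "link (ends G) (inside m G) `` {u} = A"
proof
  have "v \<in> A" if "(u, v) \<in> link (ends G) (inside m G)" for v
    using that[unfolded link_def]
  proof (induction rule: rtrancl_induct)
    case (step y z)
    then obtain e B where "B \<in> tc_components m G" "ends G e = {y, z}" "e \<in> inner G B"
      by (auto simp: inside_def)
    then show ?case using step.IH A components_disjoint[OF G m] by (auto simp: inner_def)
  qed (rule u)
  then show "link (ends G) (inside m G) `` {u} \<subseteq> A" by auto
  obtain T where "packing m G A T" using component_packing[OF G m A] by blast
  then have "T 0 \<subseteq> inner G A" "A \<times> A \<subseteq> link (ends G) (T 0)" using m by (auto simp: packing_def)
  moreover have "inner G A \<subseteq> inside m G" using A by (auto simp: inside_def)
  ultimately have "A \<times> A \<subseteq> link (ends G) (inside m G)"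
    using link_mono[of "T 0" "inside m G" "ends G"] by blast
  then show "A \<subseteq> link (ends G) (inside m G) `` {u}" using u by auto
qed

lemma classes_inside:
  assumes G: "multigraph G" and m: "m \<ge> 1"
  shows "classes (ends G) (verts G) (inside m G) = tc_components m G"
proof
  show "classes (ends G) (verts G) (inside m G) \<subseteq> tc_components m G"
    using link_inside[OF G m] components_cover[OF G m] by (force simp: classes_def)
  show "tc_components m G \<subseteq> classes (ends G) (verts G) (inside m G)"
  proof
    fix A assume A: "A \<in> tc_components m G"
    then obtain u where "u \<in> A" "u \<in> verts G" using component_packing[OF G m] by blast
    then show "A \<in> classes (ends G) (verts G) (inside m G)"
      using link_inside[OF G m A] by (auto simp: classes_def)
  qed
qed

lemma rk_inside:
  "multigraph G \<Longrightarrow> m \<ge> 1 \<Longrightarrow>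
    rk G (inside m G) = int (card (verts G)) - int (card (tc_components m G))"
  by (simp add: rk_def classes_inside)

text \<open>The packings of the parts are glued index by index. Sets from different parts cannot
  share an edge, since its ends would lie in both parts. Each \<open>T i\<close> can then stand in
  for all of \<open>inside m G\<close>.\<close>

lemma inside_packing:
  assumes G: "multigraph G" and m: "m \<ge> 1"
  shows "\<exists>T. (\<forall>i<m. T i \<subseteq> inside m G \<and> link (ends G) (inside m G) \<subseteq> link (ends G) (T i)) \<and>
    (\<forall>i<m. \<forall>j<m. i \<noteq> j \<longrightarrow> T i \<inter> T j = {})"
proof -
  let ?Q = "tc_components m G"
  obtain P where P: "\<And>A. A \<in> ?Q \<Longrightarrow> packing m G A (P A)"
    using component_packing(3)[OF G m] by metis
  define T where "T i = (\<Union>A\<in>?Q. P A i)" for i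
  have in_inner: "P A i \<subseteq> inner G A" if "A \<in> ?Q" "i < m" for A i
    using P that by (auto simp: packing_def)
  have "link (ends G) (inside m G) \<subseteq> link (ends G) (T i)" if i: "i < m" for i
  proof (rule link_least)
    fix e u v assume "e \<in> inside m G" "ends G e = {u, v}"
    then obtain A where A: "A \<in> ?Q" "u \<in> A" "v \<in> A" by (auto simp: inside_def inner_def)
    then have "(u, v) \<in> link (ends G) (P A i)" using P[OF A(1)] i unfolding packing_def by blast
    moreover have "P A i \<subseteq> T i" using A by (auto simp: T_def)
    ultimately show "(u, v) \<in> link (ends G) (T i)" using link_mono by blast
  qed
  moreover have "T i \<subseteq> inside m G" if "i < m" for i
    using in_inner that by (auto simp: T_def inside_def)
  moreover have "T i \<inter> T j = {}" if ij: "i < m" "j < m" "i \<noteq> j" for i j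
  proof -
    have "e \<notin> P B j" if "e \<in> P A i" "A \<in> ?Q" "B \<in> ?Q" for e A B
    proof
      assume e: "e \<in> P B j"
      then have "e \<in> inner G A" "e \<in> inner G B" using that ij in_inner by blast+
      then have eG: "e \<in> edges G" and "ends G e \<subseteq> A" "ends G e \<subseteq> B" by (auto simp: inner_def)
      moreover obtain u v where "ends G e = {u, v}" by (rule multigraph_edgeE[OF G eG])
      ultimately have "u \<in> A" "u \<in> B" by auto
      then have "A = B" by (rule components_disjoint[OF G m that(2,3)])
      then show False using e that(1) P[OF that(2)] ij unfolding packing_def by blast
    qed
    then show ?thesis by (auto simp: T_def)
  qed
  ultimately show ?thesis by (intro exI[of _ T]) simp
qed

section \<open>Edges between components\<close>

lemma card_cross_le:
  assumes G: "multigraph G" and k: "k \<ge> 1" and X: "X \<subseteq> edges G - inside k G"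
  shows "int (card X) \<le> int k * (rk G (X \<union> inside k G) - rk G (inside k G))"
proof (rule ccontr)
  let ?I = "inside k G" and ?l = "link (ends G)"
  \<comment> \<open>Rank after contraction of \<open>?I\<close>. Adding \<open>?I\<close> to every
    set commutes with union and intersection, so submodularity carries over.\<close>
  define r where "r S = rk G (S \<union> ?I) - rk G ?I" for S
  have fin: "finite (edges G)" "finite (verts G)" using G by (auto simp: multigraph_def)
  assume "\<not> ?thesis"
  then have "\<exists>Y C. Y \<subseteq> X \<and> Y \<noteq> {} \<and> (\<forall>i<k. C i \<subseteq> Y \<and> r (C i) = r Y) \<and>
    (\<forall>i<k. \<forall>j<k. i \<noteq> j \<longrightarrow> C i \<inter> C j = {})"
  proof (intro disjoint_spanning_subsets)
    show "finite X" using X fin finite_subset by blast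
    show "r S \<le> int (card S)" if "S \<subseteq> X" for S
    proof -
      have "S \<subseteq> edges G" using that X by blast
      then show ?thesis using rk_union(3)[OF G _ subset_refl, of S ?I] by (simp add: r_def Un_commute)
    qed
    show "r S \<le> r T" if "S \<subseteq> T" "T \<subseteq> X" for S T
      unfolding r_def using rk_mono[OF G, of "S \<union> ?I" "T \<union> ?I"] that X inside_subset[of k G]
      by auto
    show "r (S \<union> T) + r (S \<inter> T) \<le> r S + r T" if "S \<subseteq> X" "T \<subseteq> X" for S T
    proof -
      have "(S \<union> ?I) \<union> (T \<union> ?I) = S \<union> T \<union> ?I" "(S \<union> ?I) \<inter> (T \<union> ?I) = S \<inter> T \<union> ?I" by auto
      then show ?thesis
        unfolding r_def using rk_submodular[OF G, of "S \<union> ?I" "T \<union> ?I"] that X inside_subset[of k G]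
        by force
    qed
  qed (use k in \<open>auto simp: r_def\<close>)
  then obtain Y C where Y: "Y \<subseteq> X" "Y \<noteq> {}" and C': "\<forall>i<k. C i \<subseteq> Y \<and> r (C i) = r Y"
    and Cd': "\<forall>i<k. \<forall>j<k. i \<noteq> j \<longrightarrow> C i \<inter> C j = {}" by (elim exE conjE)
  note C = C'[rule_format] and Cd = Cd'[rule_format]
  obtain T where T': "\<forall>i<k. T i \<subseteq> ?I \<and> ?l ?I \<subseteq> ?l (T i)"
    and Td': "\<forall>i<k. \<forall>j<k. i \<noteq> j \<longrightarrow> T i \<inter> T j = {}"
    using inside_packing[OF G k] by (elim exE conjE)
  note T = T'[rule_format] and Td = Td'[rule_format]
  obtain y where y: "y \<in> Y" using Y by blast
  then have yE: "y \<in> edges G" "y \<notin> ?I" using Y X by auto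
  obtain u v where uv: "ends G y = {u, v}" "u \<in> verts G" "v \<in> verts G"
    using multigraph_edgeE[OF G yE(1)] by blast
  \<comment> \<open>\<open>U\<close> is the class of an end of \<open>y\<close>. Since
    \<open>y\<close> lies inside no part, packing \<open>U\<close> will contradict maximality.
    \<open>R i\<close> is the part within \<open>U\<close> of \<open>C i\<close> together with the
    expansion \<open>T i\<close> of the contracted vertices.\<close>
  define U where "U = ?l (Y \<union> ?I) `` {u} \<inter> verts G"
  define R where "R i = {e \<in> C i \<union> T i. ends G e \<subseteq> U}" for i
  have YE: "Y \<union> ?I \<subseteq> edges G" using Y X inside_subset[of k G] by blast
  have pack: "packing k G U R"
    unfolding packing_def
  proof (intro conjI allI impI)
    fix i assume i: "i < k"
    have sub: "C i \<union> T i \<subseteq> Y \<union> ?I" using C[OF i] T[OF i] by blast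
    then show "R i \<subseteq> inner G U" using YE by (auto simp: R_def inner_def)
    have "rk G (C i \<union> ?I) = rk G (Y \<union> ?I)" using C[OF i] by (simp add: r_def)
    then have cards: "card (classes (ends G) (verts G) (C i \<union> ?I)) =
        card (classes (ends G) (verts G) (Y \<union> ?I))" by (simp add: rk_def)
    \<comment> \<open>\<open>T i\<close> alone replaces all of \<open>?I\<close> here, which keeps
      the \<open>k\<close> sets disjoint.\<close>
    have CT: "?l (C i \<union> ?I) \<subseteq> ?l (C i \<union> T i)"
    proof (rule link_least)
      fix e a b assume e: "e \<in> C i \<union> ?I" "ends G e = {a, b}"
      show "(a, b) \<in> ?l (C i \<union> T i)"
      proof (cases "e \<in> C i")
        case False
        then have "(a, b) \<in> ?l (T i)" using e T[OF i] link_edge[of e ?I "ends G" a b] by auto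
        then show ?thesis using link_mono[of "T i" "C i \<union> T i"] by auto
      qed (use e in \<open>auto intro: link_edge\<close>)
    qed
    have main: "(u, w) \<in> ?l (R i)" if w: "w \<in> U" for w
    proof -
      have "(u, w) \<in> ?l (C i \<union> ?I)"
        by (rule classes_eq_imp_link_subset[OF fin(2) _ cards])
          (use C[OF i] uv w in \<open>auto simp: U_def\<close>)
      then have "(u, w) \<in> ?l (C i \<union> T i)" using CT by blast
      then have "(u, w) \<in> ?l {e \<in> C i \<union> T i. ends G e \<subseteq> ?l (C i \<union> T i) `` {u}}"
        by (rule link_in_class)
      moreover have "{e \<in> C i \<union> T i. ends G e \<subseteq> ?l (C i \<union> T i) `` {u}} \<subseteq> R i"
        using link_mono[OF sub, of "ends G"] sub YE G by (fastforce simp: R_def U_def multigraph_def)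
      ultimately show ?thesis using link_mono by blast
    qed
    then show "U \<times> U \<subseteq> ?l (R i)" by (auto intro: link_trans link_sym)
  next
    fix i j assume ij: "i < k" "j < k" "i \<noteq> j"
    \<comment> \<open>The \<open>C\<close> sets avoid \<open>?I\<close> and the \<open>T\<close>
      sets lie in it, so mixed intersections vanish.\<close>
    have "C i \<inter> ?I = {}" "C j \<inter> ?I = {}" using C ij Y X by blast+
    then show "R i \<inter> R j = {}" using Cd[OF ij] Td[OF ij] T ij unfolding R_def by blast
  qed
  obtain A where A: "A \<in> tc_components k G" "u \<in> A" using components_cover[OF G k uv(2)] by blast
  have "u \<in> U" "v \<in> U" using uv y by (auto simp: U_def intro: link_edge)
  then have "U \<subseteq> A" using A by (intro component_absorbs[OF G k A(1) _ pack]) (auto simp: U_def)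
  then have "y \<in> inner G A" using \<open>u \<in> U\<close> \<open>v \<in> U\<close> uv yE by (auto simp: inner_def)
  then show False using A yE by (auto simp: inside_def)
qed

section \<open>Counting parts and comparing consecutive indices\<close>

lemma card_components_le:
  assumes G: "multigraph G" and m: "m \<ge> 1"
  shows "card (tc_components m G) \<le> card (verts G)"
proof -
  have "finite (verts G)" using G by (simp add: multigraph_def)
  then show ?thesis
    unfolding classes_inside[OF G m, symmetric] classes_def by (rule card_image_le)
qed

lemma cross_edges_Suc:
  assumes G: "multigraph G" and m: "m \<ge> 1"
  shows "int (card (cross_edges G (tc_components (Suc m) G))) \<le>
    int (card (cross_edges G (tc_components m G))) +
    int (Suc m) * (int (card (tc_components (Suc m) G)) - int (card (tc_components m G)))"
proof -
  let ?I = "inside m G" and ?J = "inside (Suc m) G"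
  have "inner G A \<subseteq> ?I" if A: "A \<in> tc_components (Suc m) G" for A
  proof -
    obtain B where "B \<in> tc_components m G" "A \<subseteq> B" using component_SucD[OF G m A] by blast
    then show ?thesis by (auto simp: inside_def inner_def)
  qed
  then have JI: "?J \<subseteq> ?I" by (auto simp: inside_def)
  have k: "Suc m \<ge> 1" by simp
  have fin: "finite (edges G)" using G by (simp add: multigraph_def)
  have eq: "edges G - ?J = (edges G - ?I) \<union> (?I - ?J)" using JI inside_subset[of m G] by blast
  have "card (edges G - ?J) = card (edges G - ?I) + card (?I - ?J)"
    unfolding eq using fin finite_subset[OF inside_subset fin] by (intro card_Un_disjoint) auto
  moreover have "int (card (?I - ?J)) \<le> int (Suc m) * (rk G ((?I - ?J) \<union> ?J) - rk G ?J)"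
    by (rule card_cross_le[OF G k]) (use inside_subset[of m G] in auto)
  \<comment> \<open>Hence the rank difference above is \<open>rk G ?I - rk G ?J\<close>, which
    equals |Q| - |P| by \<open>rk_inside\<close>.\<close>
  moreover have "(?I - ?J) \<union> ?J = ?I" using JI by blast
  ultimately show ?thesis
    unfolding cross_edges_eq[OF G m] cross_edges_eq[OF G k]
    by (simp add: rk_inside[OF G m] rk_inside[OF G k])
qed

theorem theorem2p17:
  fixes G :: "('v, 'e) mgraph" and m :: nat
  assumes "multigraph G" and "m \<ge> 1"
  shows "real_of_int (Omega m G) / real m \<le> real_of_int (Omega (m + 1) G) / real (m + 1) \<and>
         real_of_int (Omega (m + 1) G) / real (m + 1) \<le> real (card (verts G))"
proof -
  define p q a b where "p = real (card (tc_components m G))"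
    and "q = real (card (tc_components (Suc m) G))"
    and "a = real (card (cross_edges G (tc_components m G)))"
    and "b = real (card (cross_edges G (tc_components (Suc m) G)))"
  have m: "real m > 0" using assms(2) by simp
  have "b \<le> a + real (Suc m) * (q - p)"
    using cross_edges_Suc[OF assms] unfolding p_def q_def a_def b_def
    by (metis (mono_tags, lifting) of_int_add of_int_diff of_int_le_iff of_int_mult of_int_of_nat_eq)
  then have "b / (m + 1) \<le> (a + real (Suc m) * (q - p)) / (m + 1)"
    by (intro divide_right_mono) simp_all
  then have "b / (m + 1) \<le> a / (m + 1) + (q - p)"
    by (simp add: add_divide_distrib)
  \<comment> \<open>Only here does the old denominator enter: p - a/m <= p - a/(m+1) <= q -
    b/(m+1).\<close>
  moreover have "a / (m + 1) \<le> a / m"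
    using m by (intro divide_left_mono) (auto simp: a_def)
  moreover have "real_of_int (Omega m G) / real m = p - a / m"
    using m by (simp add: Omega_def p_def a_def diff_divide_distrib)
  moreover have "real_of_int (Omega (m + 1) G) / real (m + 1) = q - b / (m + 1)"
    by (simp add: Omega_def q_def b_def diff_divide_distrib)
  moreover have "b / (m + 1) \<ge> 0" by (simp add: b_def)
  moreover have "q \<le> card (verts G)"
    using card_components_le[OF assms(1), of "Suc m"] by (simp add: q_def)
  ultimately show ?thesis by linarith
qed

end
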